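(* Let $R$ be a ring with the minimum condition on right annihilators. Then the following conditions are equivalent: \begin{itemize} \item[(1)] $R$ is a right ACS ring. \item[(2)] $R$ is a right essentially Baer ring. \end{itemize}
   Context: All rings are associative with nonzero identity. A ring $R$ has the minimum condition on right annihilators if $R$ does not contain an infinite (strictly) descending chain of right ideals that are right annihilators of subsets of $R$. A ring $R$ is right ACS if the right annihilator of every element of $R$ is an essential submodule of a direct summand of $R_R$. A ring $R$ is right essentially Baer if the right annihilator of any nonempty subset of $R$ is essential in a direct summand of $R_R$. *)

theory Defs
  imports "HOL-Algebra.Ideal"
begin

locale right_ideal = additive_subgroup I R + ring R for I and R (structure) +
  assumes I_r_closed: "\<lbrakk>a \<in> I; x \<in> carrier R\<rbrakk> \<Longrightarrow> a \<otimes> x \<in> I"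

definition right_annihilator :: "('a, 'b) ring_scheme \<Rightarrow> 'a set \<Rightarrow> 'a set" where
  "right_annihilator R X = {r \<in> carrier R. \<forall>x\<in>X. x \<otimes>\<^bsub>R\<^esub> r = \<zero>\<^bsub>R\<^esub>}"

text \<open>The submodules of the right module \<open>R\<^sub>R\<close> are exactly the right ideals of \<open>R\<close>, so
  essential submodules and direct summands are expressed through right ideals.\<close>

definition essential_in :: "('a, 'b) ring_scheme \<Rightarrow> 'a set \<Rightarrow> 'a set \<Rightarrow> bool" where
  "essential_in R N M \<longleftrightarrow>
     right_ideal N R \<and> right_ideal M R \<and> N \<subseteq> M \<and>
     (\<forall>K. right_ideal K R \<and> K \<subseteq> M \<and> N \<inter> K = {\<zero>\<^bsub>R\<^esub>} \<longrightarrow> K = {\<zero>\<^bsub>R\<^esub>})"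

definition direct_summand :: "('a, 'b) ring_scheme \<Rightarrow> 'a set \<Rightarrow> bool" where
  "direct_summand R D \<longleftrightarrow>
     right_ideal D R \<and>
     (\<exists>D'. right_ideal D' R \<and> D \<inter> D' = {\<zero>\<^bsub>R\<^esub>} \<and> D <+>\<^bsub>R\<^esub> D' = carrier R)"

definition right_ACS :: "('a, 'b) ring_scheme \<Rightarrow> bool" where
  "right_ACS R \<longleftrightarrow>
     (\<forall>a\<in>carrier R. \<exists>D. direct_summand R D \<and> essential_in R (right_annihilator R {a}) D)"

definition right_essentially_Baer :: "('a, 'b) ring_scheme \<Rightarrow> bool" where
  "right_essentially_Baer R \<longleftrightarrow>
     (\<forall>X. X \<subseteq> carrier R \<and> X \<noteq> {} \<longrightarrow>
        (\<exists>D. direct_summand R D \<and> essential_in R (right_annihilator R X) D))"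

text \<open>That the members of the chain are right ideals is automatic, see
  \<open>right_annihilator_right_ideal\<close> below.\<close>

definition min_cond_right_annihilators :: "('a, 'b) ring_scheme \<Rightarrow> bool" where
  "min_cond_right_annihilators R \<longleftrightarrow>
     \<not> (\<exists>C :: nat \<Rightarrow> 'a set.
          (\<forall>n. \<exists>X \<subseteq> carrier R. C n = right_annihilator R X) \<and>
          (\<forall>n. C (Suc n) \<subset> C n))"

lemma right_annihilator_right_ideal:
  assumes "ring R" and "X \<subseteq> carrier R"
  shows "right_ideal (right_annihilator R X) R"
proof -
  interpret ring R by fact
  have X: "x \<in> carrier R" if "x \<in> X" for x
    using that assms(2) by blast
  have "subgroup (right_annihilator R X) (add_monoid R)"
  proof (rule add.subgroupI)
    show "right_annihilator R X \<subseteq> carrier R"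
      by (auto simp: right_annihilator_def)
    show "right_annihilator R X \<noteq> {}"
      using X by (auto simp: right_annihilator_def intro!: exI[of _ "\<zero>\<^bsub>R\<^esub>"])
  qed (use X in \<open>auto simp: right_annihilator_def r_minus r_distr\<close>)
  then have "additive_subgroup (right_annihilator R X) R"
    by (rule additive_subgroup.intro)
  moreover have "right_ideal_axioms (right_annihilator R X) R"
    by (rule right_ideal_axioms.intro)
       (use X in \<open>auto simp: right_annihilator_def m_assoc[symmetric]\<close>)
  ultimately show ?thesis
    using assms(1) by (intro right_ideal.intro)
qed

end

theory Submission
  imports Defs
begin

text \<open>
  The implication from right essentially Baer to right ACS is the case of singletons. For the
  converse, the minimum condition gives \<open>r(X) = r(F)\<close> for some finite nonempty
  \<open>F \<subseteq> X\<close>, where \<open>r\<close> denotes the right annihilator, and \<open>r(F)\<close> is a finite intersection of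
  annihilators of elements. Each of these is essential in a summand, and intersecting finitely
  many essential inclusions gives an essential inclusion. So it suffices that in a right ACS ring
  the intersection of two summands \<open>eR\<close> and \<open>fR\<close> is essential in a summand
  (\<open>direct_summand_Int_essential\<close>).

  This is seen from the single element \<open>(1 - f)e\<close>, whose annihilator is
  \<open>(1 - e)R \<oplus> (eR \<inter> fR)\<close>. It is essential in some summand \<open>gR\<close>. Since \<open>gR\<close> contains
  \<open>(1 - e)R\<close>, the modular law gives \<open>gR = (1 - e)R \<oplus> (eR \<inter> gR)\<close>; hence \<open>eR \<inter> gR\<close> is again a
  summand, generated by the idempotent \<open>eg\<close>, and \<open>eR \<inter> fR\<close> is essential in it.
\<close>

lemma right_ideal_Int:
  assumes "right_ideal I R" and "right_ideal J R"
  shows "right_ideal (I \<inter> J) R"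
proof -
  interpret I: right_ideal I R by fact
  interpret J: right_ideal J R by fact
  have "subgroup (I \<inter> J) (add_monoid R)"
    using I.a_subgroup J.a_subgroup by (rule I.add.subgroups_Inter_pair)
  then show ?thesis
    by (intro right_ideal.intro additive_subgroup.intro right_ideal_axioms.intro I.ring_axioms)
       (auto intro: I.I_r_closed J.I_r_closed)
qed

text \<open>
  A right ideal \<open>K\<close> that meets \<open>N \<inter> N'\<close> trivially is handled by testing the right ideal
  \<open>N \<inter> K\<close> against \<open>N'\<close> first, and then \<open>K\<close> itself against \<open>N\<close>.
\<close>

lemma essential_in_Int:
  assumes "essential_in R N M" and "essential_in R N' M'"
  shows "essential_in R (N \<inter> N') (M \<inter> M')"
proof -
  have N: "right_ideal N R" "right_ideal M R" "N \<subseteq> M"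
    and essN: "\<And>K. right_ideal K R \<Longrightarrow> K \<subseteq> M \<Longrightarrow> N \<inter> K = {\<zero>\<^bsub>R\<^esub>} \<Longrightarrow> K = {\<zero>\<^bsub>R\<^esub>}"
    using assms(1) unfolding essential_in_def by blast+
  have N': "right_ideal N' R" "right_ideal M' R" "N' \<subseteq> M'"
    and essN': "\<And>K. right_ideal K R \<Longrightarrow> K \<subseteq> M' \<Longrightarrow> N' \<inter> K = {\<zero>\<^bsub>R\<^esub>} \<Longrightarrow> K = {\<zero>\<^bsub>R\<^esub>}"
    using assms(2) unfolding essential_in_def by blast+
  have "K = {\<zero>\<^bsub>R\<^esub>}"
    if K: "right_ideal K R" "K \<subseteq> M \<inter> M'" "N \<inter> N' \<inter> K = {\<zero>\<^bsub>R\<^esub>}" for K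
  proof (rule essN)
    show "N \<inter> K = {\<zero>\<^bsub>R\<^esub>}"
    proof (rule essN')
      show "right_ideal (N \<inter> K) R"
        by (rule right_ideal_Int[OF N(1) K(1)])
      show "N \<inter> K \<subseteq> M'" "N' \<inter> (N \<inter> K) = {\<zero>\<^bsub>R\<^esub>}"
        using K by blast+
    qed
  qed (use K in blast)+
  then show ?thesis
    using N N' right_ideal_Int unfolding essential_in_def by blast
qed

lemma essential_in_trans:
  assumes "essential_in R N M" and "essential_in R M L"
  shows "essential_in R N L"
proof -
  have N: "right_ideal N R" "right_ideal M R" "N \<subseteq> M"
    and essN: "\<And>K. right_ideal K R \<Longrightarrow> K \<subseteq> M \<Longrightarrow> N \<inter> K = {\<zero>\<^bsub>R\<^esub>} \<Longrightarrow> K = {\<zero>\<^bsub>R\<^esub>}"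
    using assms(1) unfolding essential_in_def by blast+
  have L: "right_ideal L R" "M \<subseteq> L"
    and essM: "\<And>K. right_ideal K R \<Longrightarrow> K \<subseteq> L \<Longrightarrow> M \<inter> K = {\<zero>\<^bsub>R\<^esub>} \<Longrightarrow> K = {\<zero>\<^bsub>R\<^esub>}"
    using assms(2) unfolding essential_in_def by blast+
  have "K = {\<zero>\<^bsub>R\<^esub>}"
    if K: "right_ideal K R" "K \<subseteq> L" "N \<inter> K = {\<zero>\<^bsub>R\<^esub>}" for K
  proof (rule essM)
    show "M \<inter> K = {\<zero>\<^bsub>R\<^esub>}"
    proof (rule essN)
      show "right_ideal (M \<inter> K) R"
        by (rule right_ideal_Int[OF N(2) K(1)])
      show "M \<inter> K \<subseteq> M" "N \<inter> (M \<inter> K) = {\<zero>\<^bsub>R\<^esub>}"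
        using K N(3) by blast+
    qed
  qed (use K in blast)+
  then show ?thesis
    using N L unfolding essential_in_def by blast
qed

context ring
begin

text \<open>
  The summand generated by an idempotent \<open>e\<close> is written as the annihilator of \<open>1 - e\<close>, so that
  it is known to be a right ideal; as a set it consists of the fixed points of left
  multiplication by \<open>e\<close>.
\<close>

lemma mem_right_annihilator_complement:
  assumes "e \<in> carrier R"
  shows "x \<in> right_annihilator R {\<one> \<ominus> e} \<longleftrightarrow> x \<in> carrier R \<and> e \<otimes> x = x"
proof (cases "x \<in> carrier R")
  case True
  have "(\<one> \<ominus> e) \<otimes> x = x \<ominus> e \<otimes> x"
    using assms True by (simp add: minus_eq l_distr l_minus)
  moreover have "x \<ominus> e \<otimes> x = \<zero> \<longleftrightarrow> e \<otimes> x = x"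
    using assms True by (metis minus_eq minus_equality minus_minus a_inv_closed m_closed r_neg)
  ultimately show ?thesis
    using True by (simp add: right_annihilator_def)
qed (simp add: right_annihilator_def)

text \<open>
  The component of the identity in a summand is an idempotent that generates the summand.
\<close>

lemma direct_summand_iff_idempotent:
  "direct_summand R D \<longleftrightarrow>
     (\<exists>e\<in>carrier R. e \<otimes> e = e \<and> D = right_annihilator R {\<one> \<ominus> e})"
proof
  assume "direct_summand R D"
  then obtain D' where D: "right_ideal D R" and D': "right_ideal D' R"
    and int: "D \<inter> D' = {\<zero>}" and sum: "D <+>\<^bsub>R\<^esub> D' = carrier R"
    by (auto simp: direct_summand_def)
  interpret D: right_ideal D R by fact
  interpret D': right_ideal D' R by fact
  obtain e e' where e: "e \<in> D" "e' \<in> D'" "\<one> = e \<oplus> e'"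
    using one_closed unfolding sum[symmetric] set_add_def' by blast
  have ec: "e \<in> carrier R" "e' \<in> carrier R"
    using e D.a_subset D'.a_subset by blast+
  have fix_D: "e \<otimes> x = x" if "x \<in> D" for x
  proof -
    have x: "x \<in> carrier R" using that D.a_subset by blast
    have *: "x = e \<otimes> x \<oplus> e' \<otimes> x"
      using ec x e(3) by (metis l_distr l_one)
    have "e' \<otimes> x = x \<ominus> e \<otimes> x"
      using ec x * by (metis add.inv_solve_right add.m_comm minus_eq m_closed)
    also have "\<dots> \<in> D"
      using that e(1) x by (simp add: minus_eq D.I_r_closed)
    finally have "e' \<otimes> x \<in> D \<inter> D'"
      using e(2) x by (simp add: D'.I_r_closed)
    then have "e' \<otimes> x = \<zero>"
      using int by blast
    then show ?thesis
      using * ec x by simp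
  qed
  have "x \<in> D" if "x \<in> carrier R" "e \<otimes> x = x" for x
    using D.I_r_closed[OF e(1) that(1)] that(2) by simp
  then have "D = right_annihilator R {\<one> \<ominus> e}"
    using fix_D D.a_subset mem_right_annihilator_complement[OF ec(1)] by auto
  then show "\<exists>e\<in>carrier R. e \<otimes> e = e \<and> D = right_annihilator R {\<one> \<ominus> e}"
    using ec fix_D[OF e(1)] by blast
next
  assume "\<exists>e\<in>carrier R. e \<otimes> e = e \<and> D = right_annihilator R {\<one> \<ominus> e}"
  then obtain e where e: "e \<in> carrier R" "e \<otimes> e = e"
    and D: "D = right_annihilator R {\<one> \<ominus> e}"
    by blast
  note mem = mem_right_annihilator_complement[OF e(1), folded D]
  let ?D' = "right_annihilator R {e}"
  have rid: "right_ideal D R" "right_ideal ?D' R"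
    unfolding D using e by (auto intro!: right_annihilator_right_ideal ring_axioms)
  have "D \<inter> ?D' = {\<zero>}"
    using e by (auto simp: mem right_annihilator_def)
  moreover have "x \<in> D <+>\<^bsub>R\<^esub> ?D'" if x: "x \<in> carrier R" for x
  proof -
    have "e \<otimes> x \<in> D"
      using e x by (simp add: mem m_assoc[symmetric])
    moreover have "x \<ominus> e \<otimes> x \<in> ?D'"
      using e x by (simp add: right_annihilator_def minus_eq r_distr r_minus m_assoc[symmetric] r_neg)
    moreover have "x = e \<otimes> x \<oplus> (x \<ominus> e \<otimes> x)"
      using e x by (simp add: minus_eq a_lcomm r_neg)
    ultimately show ?thesis
      unfolding set_add_def' by blast
  qed
  moreover have "D <+>\<^bsub>R\<^esub> ?D' \<subseteq> carrier R"
    by (auto simp: set_add_def' mem right_annihilator_def)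
  ultimately show "direct_summand R D"
    using rid unfolding direct_summand_def by blast
qed

text \<open>
  If \<open>gR\<close> contains \<open>(1 - e)R\<close>, the modular law splits \<open>(1 - e)R\<close> off \<open>gR\<close> with complement
  \<open>eR \<inter> gR\<close>. The projection onto that complement is left multiplication by \<open>eg\<close>.
\<close>

lemma direct_summand_Int:
  assumes e: "e \<in> carrier R" "e \<otimes> e = e" and g: "g \<in> carrier R" "g \<otimes> g = g"
    and ge: "g \<otimes> (\<one> \<ominus> e) = \<one> \<ominus> e"
  shows "direct_summand R (right_annihilator R {\<one> \<ominus> e} \<inter> right_annihilator R {\<one> \<ominus> g})"
proof -
  \<comment> \<open>Since \<open>g\<close> fixes \<open>(1 - e)R\<close>, it fixes \<open>(1 - e)g = g - eg\<close>; it also fixes \<open>g\<close>, hence \<open>eg\<close>.\<close>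
  have "(\<one> \<ominus> e) \<otimes> g = g \<ominus> e \<otimes> g"
    using e g by (simp add: minus_eq l_distr l_minus)
  moreover have "g \<otimes> ((\<one> \<ominus> e) \<otimes> g) = (\<one> \<ominus> e) \<otimes> g"
    using e g ge by (simp add: m_assoc[symmetric])
  moreover have "g \<otimes> (g \<ominus> e \<otimes> g) = g \<ominus> g \<otimes> (e \<otimes> g)"
    using e g by (simp add: minus_eq r_distr r_minus)
  ultimately have "g \<ominus> g \<otimes> (e \<otimes> g) = g \<ominus> e \<otimes> g"
    by simp
  then have "\<ominus> (g \<otimes> (e \<otimes> g)) = \<ominus> (e \<otimes> g)"
    using e g by (simp add: minus_eq)
  then have geg: "g \<otimes> (e \<otimes> g) = e \<otimes> g"
    using e g by (metis m_closed minus_minus)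
  have "e \<otimes> g \<otimes> (e \<otimes> g) = e \<otimes> g"
    using e g geg by (metis m_assoc m_closed)
  moreover have "right_annihilator R {\<one> \<ominus> e} \<inter> right_annihilator R {\<one> \<ominus> g}
      = right_annihilator R {\<one> \<ominus> e \<otimes> g}"
  proof -
    have "e \<otimes> x = x" "g \<otimes> x = x" if "x \<in> carrier R" "e \<otimes> g \<otimes> x = x" for x
      using that e g geg by (metis m_assoc m_closed)+
    then show ?thesis
      using e g by (auto simp: mem_right_annihilator_complement m_assoc)
  qed
  ultimately show ?thesis
    using e g unfolding direct_summand_iff_idempotent by blast
qed

text \<open>
  With \<open>D = eR\<close> and \<open>E = fR\<close>, the annihilator of \<open>(1 - f)e\<close> cuts \<open>E\<close> out of \<open>D\<close> and contains
  the complement \<open>(1 - e)R\<close> of \<open>D\<close>. The second property is what makes the intersection of \<open>D\<close>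
  with the summand supplied by the ACS condition a summand again.
\<close>

lemma direct_summand_Int_essential:
  assumes acs: "right_ACS R" and D: "direct_summand R D" and E: "direct_summand R E"
  shows "\<exists>L. direct_summand R L \<and> essential_in R (D \<inter> E) L"
proof -
  obtain e where e: "e \<in> carrier R" "e \<otimes> e = e" and De: "D = right_annihilator R {\<one> \<ominus> e}"
    using D direct_summand_iff_idempotent by blast
  obtain f where f: "f \<in> carrier R" "f \<otimes> f = f" and Ef: "E = right_annihilator R {\<one> \<ominus> f}"
    using E direct_summand_iff_idempotent by blast
  define a where "a = (\<one> \<ominus> f) \<otimes> e"
  have a: "a \<in> carrier R"
    using e f by (simp add: a_def)
  obtain G where G: "direct_summand R G" and ess: "essential_in R (right_annihilator R {a}) G"
    using acs a by (auto simp: right_ACS_def)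
  obtain g where g: "g \<in> carrier R" "g \<otimes> g = g" and Gg: "G = right_annihilator R {\<one> \<ominus> g}"
    using G direct_summand_iff_idempotent by blast
  have "e \<otimes> (\<one> \<ominus> e) = \<zero>"
    using e by (simp add: minus_eq r_distr r_minus r_neg)
  then have "\<one> \<ominus> e \<in> right_annihilator R {a}"
    using e f by (simp add: right_annihilator_def a_def m_assoc)
  then have "\<one> \<ominus> e \<in> G"
    using ess by (auto simp: essential_in_def)
  then have "g \<otimes> (\<one> \<ominus> e) = \<one> \<ominus> e"
    using g by (simp add: Gg mem_right_annihilator_complement)
  then have L: "direct_summand R (D \<inter> G)"
    unfolding De Gg by (intro direct_summand_Int e g)
  have "D \<inter> E = D \<inter> right_annihilator R {a}"
  proof -
    have "x \<in> E \<longleftrightarrow> x \<in> right_annihilator R {a}" if "x \<in> D" for x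
    proof -
      have x: "x \<in> carrier R" "e \<otimes> x = x"
        using that e by (simp_all add: De mem_right_annihilator_complement)
      then have "a \<otimes> x = (\<one> \<ominus> f) \<otimes> x"
        using e f by (simp add: a_def m_assoc)
      then show ?thesis
        by (simp add: Ef right_annihilator_def)
    qed
    then show ?thesis
      by blast
  qed
  moreover have "essential_in R D D"
    using D unfolding essential_in_def direct_summand_def by (auto dest: Int_absorb1)
  ultimately have "essential_in R (D \<inter> E) (D \<inter> G)"
    using essential_in_Int ess by metis
  then show ?thesis
    using L by blast
qed

lemma right_annihilator_finite_essential:
  assumes acs: "right_ACS R" and "finite F" "F \<noteq> {}" "F \<subseteq> carrier R"
  shows "\<exists>D. direct_summand R D \<and> essential_in R (right_annihilator R F) D"
  using assms(2-)
proof (induction F rule: finite_ne_induct)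
  case (singleton x)
  then show ?case
    using acs by (simp add: right_ACS_def)
next
  case (insert x F)
  obtain D where D: "direct_summand R D" "essential_in R (right_annihilator R F) D"
    using insert by auto
  obtain E where E: "direct_summand R E" "essential_in R (right_annihilator R {x}) E"
    using acs insert.prems by (auto simp: right_ACS_def)
  have "right_annihilator R (insert x F) = right_annihilator R F \<inter> right_annihilator R {x}"
    by (auto simp: right_annihilator_def)
  then have "essential_in R (right_annihilator R (insert x F)) (D \<inter> E)"
    using essential_in_Int[OF D(2) E(2)] by simp
  then show ?case
    using direct_summand_Int_essential[OF acs D(1) E(1)] essential_in_trans by blast
qed

end

text \<open>
  Among the annihilators of finite nonempty subsets of \<open>X\<close> there is a minimal one, and adding
  any further element of \<open>X\<close> to the subset cannot shrink it.
\<close>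

lemma right_annihilator_eq_finite:
  assumes min: "min_cond_right_annihilators R" and X: "X \<subseteq> carrier R" "X \<noteq> {}"
  obtains F where "finite F" "F \<noteq> {}" "F \<subseteq> X"
    and "right_annihilator R X = right_annihilator R F"
proof -
  let ?S = "right_annihilator R ` {F. finite F \<and> F \<noteq> {} \<and> F \<subseteq> X}"
  let ?r = "{(A, B). A \<in> ?S \<and> B \<in> ?S \<and> A \<subset> B}"
  have "wf ?r"
    unfolding wf_iff_no_infinite_down_chain
  proof
    assume "\<exists>C. \<forall>i. (C (Suc i), C i) \<in> ?r"
    then obtain C where "\<And>i. (C (Suc i), C i) \<in> ?r"
      by blast
    then have C: "C i \<in> ?S" "C (Suc i) \<subset> C i" for i
      by blast+
    have "\<exists>Y\<subseteq>carrier R. C n = right_annihilator R Y" for n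
      using C(1)[of n] X(1) by blast
    then show False
      using min C(2) unfolding min_cond_right_annihilators_def by blast
  qed
  moreover obtain x where "x \<in> X"
    using X(2) by blast
  then have "right_annihilator R {x} \<in> ?S"
    by blast
  ultimately obtain M where M: "M \<in> ?S" and minimal: "\<And>A. (A, M) \<in> ?r \<Longrightarrow> A \<notin> ?S"
    by (rule wfE_min) blast
  then obtain F where F: "finite F" "F \<noteq> {}" "F \<subseteq> X" "M = right_annihilator R F"
    by blast
  have "right_annihilator R F \<subseteq> right_annihilator R {x}" if "x \<in> X" for x
  proof -
    have "right_annihilator R (insert x F) \<in> ?S"
      using F that by blast
    then have "\<not> right_annihilator R (insert x F) \<subset> M"
      using minimal M by blast
    then have "right_annihilator R (insert x F) = right_annihilator R F"
      unfolding F(4) by (auto simp: right_annihilator_def)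
    then show ?thesis
      by (auto simp: right_annihilator_def)
  qed
  then have "right_annihilator R X = right_annihilator R F"
    using F(3) by (fastforce simp: right_annihilator_def)
  then show thesis
    using that F by blast
qed

theorem corollary2p11:
  fixes R :: "('a, 'b) ring_scheme"
  assumes "ring R" and "\<one>\<^bsub>R\<^esub> \<noteq> \<zero>\<^bsub>R\<^esub>"
    and "min_cond_right_annihilators R"
  shows "right_ACS R \<longleftrightarrow> right_essentially_Baer R"
proof
  interpret ring R by fact
  assume acs: "right_ACS R"
  show "right_essentially_Baer R"
    unfolding right_essentially_Baer_def
  proof (intro allI impI)
    fix X assume X: "X \<subseteq> carrier R \<and> X \<noteq> {}"
    then obtain F where F: "finite F" "F \<noteq> {}" "F \<subseteq> X"
      and eq: "right_annihilator R X = right_annihilator R F"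
      using right_annihilator_eq_finite[OF assms(3)] by metis
    show "\<exists>D. direct_summand R D \<and> essential_in R (right_annihilator R X) D"
      unfolding eq using right_annihilator_finite_essential[OF acs F(1,2)] F(3) X by blast
  qed
next
  assume "right_essentially_Baer R"
  then show "right_ACS R"
    by (simp add: right_essentially_Baer_def right_ACS_def)
qed

end
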